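(* Let $\alpha\in[0,2\pi)$ denote the radian of the first circular arc of a path of type $CC_{2\pi}=\{RL_{2\pi},LR_{2\pi}\}$. If the solution path for the minimum-time Problem described in the context is of type $CC_{2\pi}$, the following two statements hold. (1) The solution path is of $RL_{2\pi}$ if and only if $$\theta_f=\frac{\pi}{2}-\alpha+2n\pi,\qquad w_x=\frac{\frac{X_{T0}}{\rho}-\cos\left(\frac{\pi}{2}+\theta_f\right)-1}{\frac{\pi}{2}-\theta_f+2(n+1)\pi},\qquad w_y=\frac{\frac{Y_{T0}}{\rho}-\sin\left(\frac{\pi}{2}+\theta_f\right)}{\frac{\pi}{2}-\theta_f+2(n+1)\pi},$$ where $n=0$ if $\theta_f<\pi/2$ and $n=1$ if $\theta_f\ge\pi/2$. In addition, if these three equations hold, then $\alpha$ is a root of $a_1\alpha^2+a_2\alpha+a_3=0$, where $$a_1=\rho^2w_y^2+\rho^2w_x^2,$$ $$a_2=4\pi\rho^2(w_y^2+w_x^2)-2\rho(w_yY_{T0}+w_xX_{T0}-\rho w_x),$$ $$a_3=4\pi^2\rho^2(w_y^2+w_x^2)-4\pi\rho(w_yY_{T0}+w_xX_{T0}-\rho w_x)+Y_{T0}^2+X_{T0}^2-2\rho X_{T0}.$$ (2) The solution path is of $LR_{2\pi}$ if and only if $$\theta_f=\alpha+\frac{\pi}{2}-2n\pi,\qquad w_x=\frac{\frac{X_{T0}}{\rho}-\cos\left(\theta_f-\frac{\pi}{2}\right)+1}{\theta_f-\frac{\pi}{2}+2(n+1)\pi},\qquad w_y=\frac{\frac{Y_{T0}}{\rho}-\sin\left(\theta_f-\frac{\pi}{2}\right)}{\theta_f-\frac{\pi}{2}+2(n+1)\pi},$$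 where $n=0$ if $\theta_f\ge\pi/2$ and $n=1$ if $\theta_f<\pi/2$. In addition, if these three equations hold, then $\alpha$ is a root of $b_1\alpha^2+b_2\alpha+b_3=0$, where $$b_1=\rho^2w_y^2+\rho^2w_x^2,$$ $$b_2=4\pi\rho^2(w_y^2+w_x^2)-2\rho(w_yY_{T0}+w_xX_{T0}-\rho w_x),$$ $$b_3=4\pi^2\rho^2(w_y^2+w_x^2)-4\pi\rho(w_yY_{T0}+w_xX_{T0}-\rho w_x)+Y_{T0}^2+X_{T0}^2+2\rho X_{T0}.$$
   Context: Dubins airplane (in the air-relative frame, which moves with the steady wind; speed normalized to one): the state is $(x,y,\theta)$, with position $(x,y)\in\mathbb{R}^2$ and heading angle $\theta\in[0,2\pi)$ measured counterclockwise from the $x$-axis, governed by $$\dot x=\cos\theta,\qquad \dot y=\sin\theta,\qquad \dot\theta=u/\rho,\qquad u(t)\in[-1,1],$$ where $\rho>0$ is a constant related to the minimum turning radius. The initial state at $t=0$ is $(x_0,y_0,\theta_0)=(0,0,\pi/2)$. Problem: find a minimum time $t_f>0$ and a measurable control $u(\cdot)\in[-1,1]$ on $[0,t_f]$ so that the system is steered from $(x_0,y_0,\theta_0)$ to a target $(x_f,y_f,\theta_f)$ satisfying $(x_f,y_f)=(X_{T0},Y_{T0})-t_f(w_x,w_y)$. Here $(w_x,w_y)\in\mathbb{R}^2$ is the constant velocity of the wind in the inertial frame, assumed to satisfy $w_x^2+w_y^2<1$, $(X_{T0},Y_{T0})$ is the position of the target in the inertial frame (whose origin is the initial position of the airplane),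 and $\theta_f$ is the prescribed final heading angle. Path types: $L$ denotes a counterclockwise circular arc ($u=1$), $R$ a clockwise circular arc ($u=-1$), and $C$ stands for $L$ or $R$; a subscript $2\pi$ means that the arc has radian $2\pi$. A path of type $RL_{2\pi}$ whose first arc has radian $\alpha$ is generated by $u=-1$ on $[0,\rho\alpha)$ and $u=1$ on $[\rho\alpha,\rho(\alpha+2\pi)]$; a path of type $LR_{2\pi}$ whose first arc has radian $\alpha$ is generated by $u=1$ on $[0,\rho\alpha)$ and $u=-1$ on $[\rho\alpha,\rho(\alpha+2\pi)]$.
   Formalization: In b_2 and b_3 the term "-ρw_x" is corrected to "+ρw_x" (the printed sign fails unless w_x=0), and the case of an RL_{2π} path with α=0 (a single counterclockwise circle), where the printed choice of n makes (1) false, is excluded. *)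

theory Defs
  imports "HOL-Analysis.Analysis"
begin

text \<open>
  The airplane moves in the air-relative frame with unit speed. Solutions of the control system for
  a measurable control are meant in the sense of Caratheodory, i.e. as solutions of the integrated
  equations. The heading \<open>\<theta>\<close> is the continuous lift of the angle to the real line; the prescribed
  final heading in \<open>[0, 2 pi)\<close> is compared with it modulo \<open>2 pi\<close> in \<open>steers\<close>.
\<close>

definition dubins_trajectory ::
  "real \<Rightarrow> real \<Rightarrow> (real \<Rightarrow> real) \<Rightarrow> (real \<Rightarrow> real) \<Rightarrow> (real \<Rightarrow> real) \<Rightarrow> (real \<Rightarrow> real) \<Rightarrow> bool"
  where
  "dubins_trajectory \<rho> tf u x y \<theta> \<longleftrightarrow>
     u \<in> borel_measurable (lebesgue_on {0..tf}) \<and>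
     (\<forall>t\<in>{0..tf}. u t \<in> {-1..1}) \<and>
     x 0 = 0 \<and> y 0 = 0 \<and> \<theta> 0 = pi / 2 \<and>
     (\<forall>t\<in>{0..tf}.
        ((\<lambda>s. cos (\<theta> s)) has_integral (x t - x 0)) {0..t} \<and>
        ((\<lambda>s. sin (\<theta> s)) has_integral (y t - y 0)) {0..t} \<and>
        ((\<lambda>s. u s / \<rho>) has_integral (\<theta> t - \<theta> 0)) {0..t})"

definition steers ::
  "real \<Rightarrow> real \<Rightarrow> real \<Rightarrow> real \<Rightarrow> real \<Rightarrow> real \<Rightarrow>
   real \<Rightarrow> (real \<Rightarrow> real) \<Rightarrow> (real \<Rightarrow> real) \<Rightarrow> (real \<Rightarrow> real) \<Rightarrow> (real \<Rightarrow> real) \<Rightarrow> bool"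
  where
  "steers \<rho> wx wy XT0 YT0 \<theta>f tf u x y \<theta> \<longleftrightarrow>
     0 < tf \<and> dubins_trajectory \<rho> tf u x y \<theta> \<and>
     x tf = XT0 - tf * wx \<and> y tf = YT0 - tf * wy \<and>
     (\<exists>k::int. \<theta> tf = \<theta>f + 2 * pi * of_int k)"

definition min_time_solution ::
  "real \<Rightarrow> real \<Rightarrow> real \<Rightarrow> real \<Rightarrow> real \<Rightarrow> real \<Rightarrow>
   real \<Rightarrow> (real \<Rightarrow> real) \<Rightarrow> (real \<Rightarrow> real) \<Rightarrow> (real \<Rightarrow> real) \<Rightarrow> (real \<Rightarrow> real) \<Rightarrow> bool"
  where
  "min_time_solution \<rho> wx wy XT0 YT0 \<theta>f tf u x y \<theta> \<longleftrightarrow>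
     steers \<rho> wx wy XT0 YT0 \<theta>f tf u x y \<theta> \<and>
     (\<forall>tf' u' x' y' \<theta>'. steers \<rho> wx wy XT0 YT0 \<theta>f tf' u' x' y' \<theta>' \<longrightarrow> tf \<le> tf')"

text \<open>
  The type is a property of the path: the control of a solution is determined by its path only
  almost everywhere, so a path has type RL if it is also generated by the RL control.

  For \<open>\<alpha> = 0\<close> the two types are a single counterclockwise and a single clockwise circle, with the
  same end point, final heading (\<open>pi/2\<close>) and duration, so no condition on the data tells them apart.
  The selection of \<open>n\<close> in the lemma (at \<open>\<theta>f = pi/2\<close>: \<open>n = 1\<close> for RL, \<open>n = 0\<close> for LR) is right for the
  clockwise circle only; hence the assumption there that the path is not RL with \<open>\<alpha> = 0\<close>.

  The quadratic equations express that the end point lies on the circle of radius \<open>\<rho>\<close> around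
  \<open>(\<rho>, 0)\<close> for RL and around \<open>(-\<rho>, 0)\<close> for LR. They are exchanged by the reflection
  \<open>(XT0, wx) \<mapsto> (-XT0, -wx)\<close>, which gives the term \<open>+ \<rho> * wx\<close> in \<open>b2\<close> and \<open>b3\<close>
  (the source prints \<open>- \<rho> * wx\<close>, which is false unless \<open>wx = 0\<close>).
\<close>

definition RL_path ::
  "real \<Rightarrow> real \<Rightarrow> real \<Rightarrow> (real \<Rightarrow> real) \<Rightarrow> (real \<Rightarrow> real) \<Rightarrow> (real \<Rightarrow> real) \<Rightarrow> bool"
  where
  "RL_path \<rho> \<alpha> tf x y \<theta> \<longleftrightarrow>
     tf = \<rho> * (\<alpha> + 2 * pi) \<and>
     dubins_trajectory \<rho> tf (\<lambda>t. if t < \<rho> * \<alpha> then -1 else 1) x y \<theta>"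

definition LR_path ::
  "real \<Rightarrow> real \<Rightarrow> real \<Rightarrow> (real \<Rightarrow> real) \<Rightarrow> (real \<Rightarrow> real) \<Rightarrow> (real \<Rightarrow> real) \<Rightarrow> bool"
  where
  "LR_path \<rho> \<alpha> tf x y \<theta> \<longleftrightarrow>
     tf = \<rho> * (\<alpha> + 2 * pi) \<and>
     dubins_trajectory \<rho> tf (\<lambda>t. if t < \<rho> * \<alpha> then 1 else -1) x y \<theta>"

end

theory Submission
  imports Defs
begin

text \<open>
  A path of type CC with first arc \<open>\<alpha>\<close> ends where its first arc ends, because the second arc is a
  full circle. Its final data therefore determine the equations. Conversely, if the equations of
  one type held on a path of the other type, the two end points would agree, which forces
  \<open>cos \<alpha> = 1\<close> and hence the degenerate case \<open>\<alpha> = 0\<close>.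
\<close>

section \<open>Integrals along circular arcs and the end of a path\<close>

lemma arc_integrals:
  fixes a b c k :: real
  assumes "a \<le> b" "k \<noteq> 0"
  shows "((\<lambda>t. cos (c + k * t)) has_integral (sin (c + k * b) - sin (c + k * a)) / k) {a..b}"
    and "((\<lambda>t. sin (c + k * t)) has_integral (cos (c + k * a) - cos (c + k * b)) / k) {a..b}"
proof -
  have "((\<lambda>t. cos (c + k * t)) has_integral sin (c + k * b) / k - sin (c + k * a) / k) {a..b}"
    using assms
    by (intro fundamental_theorem_of_calculus)
       (auto intro!: derivative_eq_intros simp flip: has_real_derivative_iff_has_vector_derivative)
  then show "((\<lambda>t. cos (c + k * t)) has_integral (sin (c + k * b) - sin (c + k * a)) / k) {a..b}"
    by (simp add: diff_divide_distrib)
  have "((\<lambda>t. sin (c + k * t)) has_integral - cos (c + k * b) / k - - cos (c + k * a) / k) {a..b}"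
    using assms
    by (intro fundamental_theorem_of_calculus)
       (auto intro!: derivative_eq_intros simp flip: has_real_derivative_iff_has_vector_derivative)
  then show "((\<lambda>t. sin (c + k * t)) has_integral (cos (c + k * a) - cos (c + k * b)) / k) {a..b}"
    by (simp add: diff_divide_distrib)
qed

text \<open>The tent \<open>s * (a - \<bar>r - a\<bar>)\<close> is a continuous antiderivative off
  the single point \<open>a\<close>, and it vanishes at \<open>0\<close> because
  \<open>0 \<le> a\<close>. The absolute value lets one formula serve \<open>b\<close> on either
  side of the switch.\<close>

lemma switching_integral:
  fixes a b s :: real
  assumes "0 \<le> a" "0 \<le> b"
  shows "((\<lambda>t. if t < a then s else - s) has_integral s * (a - \<bar>b - a\<bar>)) {0..b}"
proof -
  have "((\<lambda>t. if t < a then s else - s) has_integral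
      s * (a - \<bar>b - a\<bar>) - s * (a - \<bar>0 - a\<bar>)) {0..b}"
  proof (rule fundamental_theorem_of_calculus_interior_strong[where S = "{a}"])
    fix t assume t: "t \<in> {0<..<b} - {a}"
    have "((\<lambda>r. s * (a - \<bar>r - a\<bar>)) has_real_derivative (if t < a then s else - s)) (at t)"
    proof (cases "t < a")
      case True
      \<comment> \<open>On the open half-line \<open>{..<a}\<close> around \<open>t\<close> the tent
        is \<open>s * r\<close>, on \<open>{a<..}\<close> it is \<open>s * (2 * a - r)\<close>; a
        derivative depends only on such a neighbourhood.\<close>
      have "((\<lambda>r. s * r) has_real_derivative s) (at t)"
        by (auto intro!: derivative_eq_intros)
      then have "((\<lambda>r. s * (a - \<bar>r - a\<bar>)) has_real_derivative s) (at t)"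
        by (rule DERIV_cong_ev[OF refl _ refl, THEN iffD1, rotated])
           (use True in \<open>auto intro!: eventually_mono[OF eventually_nhds_in_open[of "{..<a}"]]\<close>)
      then show ?thesis using True by simp
    next
      case False
      have "((\<lambda>r. s * (2 * a - r)) has_real_derivative - s) (at t)"
        by (auto intro!: derivative_eq_intros)
      then have "((\<lambda>r. s * (a - \<bar>r - a\<bar>)) has_real_derivative - s) (at t)"
        by (rule DERIV_cong_ev[OF refl _ refl, THEN iffD1, rotated])
           (use False t in \<open>auto intro!: eventually_mono[OF eventually_nhds_in_open[of "{a<..}"]]\<close>)
      then show ?thesis using False by simp
    qed
    then show "((\<lambda>r. s * (a - \<bar>r - a\<bar>)) has_vector_derivative (if t < a then s else - s)) (at t)"
      by (simp add: has_real_derivative_iff_has_vector_derivative)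
  qed (use assms in \<open>auto intro!: continuous_intros\<close>)
  then show ?thesis
    using assms by simp
qed

text \<open>The sign \<open>s\<close> treats both types at once: \<open>s = -1\<close> is RL and
  \<open>s = 1\<close> is LR. The integrated equations determine first the heading, then the
  position; over the second arc, a full turn, sine and cosine integrate to zero.\<close>

lemma CC_path_end:
  fixes \<rho> \<alpha> s :: real
  assumes "\<rho> > 0" "\<alpha> \<ge> 0" "s \<in> {-1, 1}"
    and path: "dubins_trajectory \<rho> tf (\<lambda>t. if t < \<rho> * \<alpha> then s else - s) x y \<theta>"
    and tf: "tf = \<rho> * (\<alpha> + 2 * pi)"
  shows "x tf = s * \<rho> * (cos \<alpha> - 1)" "y tf = \<rho> * sin \<alpha>" "\<theta> tf = pi / 2 + s * \<alpha> - 2 * pi * s"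
proof -
  let ?u = "\<lambda>t. if t < \<rho> * \<alpha> then s else - s"
  have le: "0 \<le> \<rho> * \<alpha>" "\<rho> * \<alpha> \<le> tf" "0 \<le> tf"
    using assms by (auto simp: algebra_simps)
  have heading: "\<theta> t = pi / 2 + s * (\<rho> * \<alpha> - \<bar>t - \<rho> * \<alpha>\<bar>) / \<rho>" if "t \<in> {0..tf}" for t
  proof -
    have "((\<lambda>r. ?u r / \<rho>) has_integral \<theta> t - pi / 2) {0..t}"
      using path that unfolding dubins_trajectory_def by metis
    moreover have "((\<lambda>r. ?u r / \<rho>) has_integral s * (\<rho> * \<alpha> - \<bar>t - \<rho> * \<alpha>\<bar>) / \<rho>) {0..t}"
      using has_integral_divide[OF switching_integral[of "\<rho> * \<alpha>" t s]] le that by auto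
    ultimately have "\<theta> t - pi / 2 = s * (\<rho> * \<alpha> - \<bar>t - \<rho> * \<alpha>\<bar>) / \<rho>"
      by (rule has_integral_unique)
    then show ?thesis
      by simp
  qed
  \<comment> \<open>The tent is affine on each side of the switch, so the heading has the form
    required by \<open>arc_integrals\<close>. In \<open>second\<close> the offset
    \<open>2 * s * \<alpha>\<close> makes the two formulas agree at
    \<open>t = \<rho> * \<alpha>\<close>.\<close>
  have first: "\<theta> t = pi / 2 + (s / \<rho>) * t" if "t \<in> {0..\<rho> * \<alpha>}" for t
    using heading[of t] that le \<open>\<rho> > 0\<close> by (simp add: field_simps)
  have second: "\<theta> t = (pi / 2 + 2 * s * \<alpha>) + (- s / \<rho>) * t" if "t \<in> {\<rho> * \<alpha>..tf}" for t
    using heading[of t] that le \<open>\<rho> > 0\<close> by (simp add: field_simps)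
  \<comment> \<open>The phases at the ends of the second arc differ by \<open>2 * pi * s\<close>, so
    the boundary terms there cancel.\<close>
  have ends: "(s / \<rho>) * (\<rho> * \<alpha>) = s * \<alpha>" "(- s / \<rho>) * (\<rho> * \<alpha>) = - (s * \<alpha>)"
    "(- s / \<rho>) * tf = - (s * \<alpha>) - 2 * pi * s"
    using \<open>\<rho> > 0\<close> by (auto simp: tf field_simps)
  have nz: "s / \<rho> \<noteq> 0" "- s / \<rho> \<noteq> 0"
    using assms by auto
  have x1: "((\<lambda>t. cos (\<theta> t)) has_integral s * \<rho> * (cos \<alpha> - 1)) {0..\<rho> * \<alpha>}"
  proof (rule has_integral_eq)
    show "((\<lambda>t. cos (pi / 2 + (s / \<rho>) * t)) has_integral s * \<rho> * (cos \<alpha> - 1)) {0..\<rho> * \<alpha>}"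
      using arc_integrals(1)[OF le(1) nz(1), of "pi / 2"] \<open>s \<in> {-1, 1}\<close>
      unfolding ends by (auto simp: sin_add sin_diff algebra_simps)
  qed (simp add: first)
  have x2: "((\<lambda>t. cos (\<theta> t)) has_integral 0) {\<rho> * \<alpha>..tf}"
  proof (rule has_integral_eq)
    show "((\<lambda>t. cos ((pi / 2 + 2 * s * \<alpha>) + (- s / \<rho>) * t)) has_integral 0) {\<rho> * \<alpha>..tf}"
      using arc_integrals(1)[OF le(2) nz(2), of "pi / 2 + 2 * s * \<alpha>"] \<open>s \<in> {-1, 1}\<close>
      unfolding ends by (auto simp: sin_add sin_diff cos_add cos_diff algebra_simps)
  qed (simp add: second)
  have y1: "((\<lambda>t. sin (\<theta> t)) has_integral \<rho> * sin \<alpha>) {0..\<rho> * \<alpha>}"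
  proof (rule has_integral_eq)
    show "((\<lambda>t. sin (pi / 2 + (s / \<rho>) * t)) has_integral \<rho> * sin \<alpha>) {0..\<rho> * \<alpha>}"
      using arc_integrals(2)[OF le(1) nz(1), of "pi / 2"] \<open>s \<in> {-1, 1}\<close>
      unfolding ends by (auto simp: cos_add cos_diff algebra_simps)
  qed (simp add: first)
  have y2: "((\<lambda>t. sin (\<theta> t)) has_integral 0) {\<rho> * \<alpha>..tf}"
  proof (rule has_integral_eq)
    show "((\<lambda>t. sin ((pi / 2 + 2 * s * \<alpha>) + (- s / \<rho>) * t)) has_integral 0) {\<rho> * \<alpha>..tf}"
      using arc_integrals(2)[OF le(2) nz(2), of "pi / 2 + 2 * s * \<alpha>"] \<open>s \<in> {-1, 1}\<close>
      unfolding ends by (auto simp: sin_add sin_diff cos_add cos_diff algebra_simps)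
  qed (simp add: second)
  have "((\<lambda>t. cos (\<theta> t)) has_integral x tf) {0..tf}"
    and "((\<lambda>t. sin (\<theta> t)) has_integral y tf) {0..tf}"
    using path le unfolding dubins_trajectory_def by auto
  with has_integral_combine[OF le(1,2) x1 x2] has_integral_combine[OF le(1,2) y1 y2]
  have "s * \<rho> * (cos \<alpha> - 1) + 0 = x tf" "\<rho> * sin \<alpha> + 0 = y tf"
    by (blast intro: has_integral_unique)+
  then show "x tf = s * \<rho> * (cos \<alpha> - 1)" "y tf = \<rho> * sin \<alpha>"
    by simp_all
  show "\<theta> tf = pi / 2 + s * \<alpha> - 2 * pi * s"
    using second[of tf] le unfolding ends by simp
qed

section \<open>Angles modulo \<open>2 * pi\<close>\<close>

lemma representative_unique:
  fixes a b :: real and k :: int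
  assumes "a = b + 2 * pi * of_int k" "\<bar>a - b\<bar> < 2 * pi"
  shows "a = b"
proof -
  have "2 * pi * \<bar>of_int k\<bar> < 2 * pi * (1 :: real)"
    using assms by (simp add: abs_mult)
  then have "\<bar>of_int k\<bar> < (1 :: real)"
    by (subst (asm) mult_less_cancel_left_pos) auto
  then have "k = 0"
    by linarith
  then show ?thesis
    using assms by simp
qed

lemma cos_eq_1_in_period:
  fixes a :: real
  assumes "cos a = 1" "0 \<le> a" "a < 2 * pi"
  shows "a = 0"
proof -
  obtain n :: int where "a = of_int n * 2 * pi"
    using assms(1) cos_one_2pi_int by blast
  then show ?thesis
    using representative_unique[of a 0 n] assms by (simp add: mult_ac)
qed

section \<open>Characterization of the two path types\<close>

theorem lemma1:
  fixes \<rho> wx wy XT0 YT0 \<theta>f tf \<alpha> :: real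
    and u x y \<theta> :: "real \<Rightarrow> real"
  assumes "\<rho> > 0"
    and "wx^2 + wy^2 < 1"
    and "\<theta>f \<in> {0..<2 * pi}"
    and "\<alpha> \<in> {0..<2 * pi}"
    and solution: "min_time_solution \<rho> wx wy XT0 YT0 \<theta>f tf u x y \<theta>"
    and CC_type: "RL_path \<rho> \<alpha> tf x y \<theta> \<or> LR_path \<rho> \<alpha> tf x y \<theta>"
    and nondegenerate: "\<not> (RL_path \<rho> \<alpha> tf x y \<theta> \<and> \<alpha> = 0)"
  shows
    "(let n = (if \<theta>f < pi / 2 then 0 else 1);
          equations =
            (\<theta>f = pi / 2 - \<alpha> + 2 * n * pi \<and>
             wx = (XT0 / \<rho> - cos (pi / 2 + \<theta>f) - 1) / (pi / 2 - \<theta>f + 2 * (n + 1) * pi) \<and>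
             wy = (YT0 / \<rho> - sin (pi / 2 + \<theta>f)) / (pi / 2 - \<theta>f + 2 * (n + 1) * pi));
          a1 = \<rho>^2 * wy^2 + \<rho>^2 * wx^2;
          a2 = 4 * pi * \<rho>^2 * (wy^2 + wx^2) - 2 * \<rho> * (wy * YT0 + wx * XT0 - \<rho> * wx);
          a3 = 4 * pi^2 * \<rho>^2 * (wy^2 + wx^2) - 4 * pi * \<rho> * (wy * YT0 + wx * XT0 - \<rho> * wx)
               + YT0^2 + XT0^2 - 2 * \<rho> * XT0
      in (RL_path \<rho> \<alpha> tf x y \<theta> \<longleftrightarrow> equations) \<and>
         (equations \<longrightarrow> a1 * \<alpha>^2 + a2 * \<alpha> + a3 = 0)) \<and>
     (let n = (if \<theta>f \<ge> pi / 2 then 0 else 1);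
          equations =
            (\<theta>f = \<alpha> + pi / 2 - 2 * n * pi \<and>
             wx = (XT0 / \<rho> - cos (\<theta>f - pi / 2) + 1) / (\<theta>f - pi / 2 + 2 * (n + 1) * pi) \<and>
             wy = (YT0 / \<rho> - sin (\<theta>f - pi / 2)) / (\<theta>f - pi / 2 + 2 * (n + 1) * pi));
          b1 = \<rho>^2 * wy^2 + \<rho>^2 * wx^2;
          b2 = 4 * pi * \<rho>^2 * (wy^2 + wx^2) - 2 * \<rho> * (wy * YT0 + wx * XT0 + \<rho> * wx);
          b3 = 4 * pi^2 * \<rho>^2 * (wy^2 + wx^2) - 4 * pi * \<rho> * (wy * YT0 + wx * XT0 + \<rho> * wx)
               + YT0^2 + XT0^2 + 2 * \<rho> * XT0
      in (LR_path \<rho> \<alpha> tf x y \<theta> \<longleftrightarrow> equations) \<and>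
         (equations \<longrightarrow> b1 * \<alpha>^2 + b2 * \<alpha> + b3 = 0))"
proof -
  have circle: "(cos \<alpha>)\<^sup>2 + (sin \<alpha>)\<^sup>2 = 1"
    by simp
  have tf_pos: "\<alpha> + 2 * pi > 0"
    using assms pi_gt_zero by (auto intro: add_nonneg_pos)
  obtain k :: int where target: "x tf = XT0 - tf * wx" "y tf = YT0 - tf * wy"
      "\<theta> tf = \<theta>f + 2 * pi * of_int k"
    using solution unfolding min_time_solution_def steers_def by auto
  \<comment> \<open>These definitions repeat the \<open>let\<close> bindings of the goal literally,
    so that the last step can fold them back.\<close>
  define nR nL :: real where "nR = (if \<theta>f < pi / 2 then 0 else 1)"
    and "nL = (if \<theta>f \<ge> pi / 2 then 0 else 1)"
  define EqR where "EqR \<longleftrightarrow> \<theta>f = pi / 2 - \<alpha> + 2 * nR * pi \<and>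
             wx = (XT0 / \<rho> - cos (pi / 2 + \<theta>f) - 1) / (pi / 2 - \<theta>f + 2 * (nR + 1) * pi) \<and>
             wy = (YT0 / \<rho> - sin (pi / 2 + \<theta>f)) / (pi / 2 - \<theta>f + 2 * (nR + 1) * pi)"
  define EqL where "EqL \<longleftrightarrow> \<theta>f = \<alpha> + pi / 2 - 2 * nL * pi \<and>
             wx = (XT0 / \<rho> - cos (\<theta>f - pi / 2) + 1) / (\<theta>f - pi / 2 + 2 * (nL + 1) * pi) \<and>
             wy = (YT0 / \<rho> - sin (\<theta>f - pi / 2)) / (\<theta>f - pi / 2 + 2 * (nL + 1) * pi)"
  have nR01: "nR = 0 \<or> nR = 1" and nL01: "nL = 0 \<or> nL = 1"
    by (auto simp: nR_def nL_def)
  \<comment> \<open>Each wind equation is the end point condition solved for the wind: the duration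
    is \<open>\<rho> * (\<alpha> + 2 * pi)\<close> and \<open>\<rho> * b\<close> is a coordinate of
    the end point.\<close>
  have scaled: "w = (z / \<rho> - b) / (\<alpha> + 2 * pi) \<longleftrightarrow> z - \<rho> * (\<alpha> + 2 * pi) * w = \<rho> * b" for w z b
  proof -
    have "w = (z / \<rho> - b) / (\<alpha> + 2 * pi) \<longleftrightarrow> w * (\<alpha> + 2 * pi) = z / \<rho> - b"
      using tf_pos by (simp add: eq_divide_eq)
    also have "\<dots> \<longleftrightarrow> z - \<rho> * (\<alpha> + 2 * pi) * w = \<rho> * b"
      using \<open>\<rho> > 0\<close> by (auto simp: field_simps)
    finally show ?thesis .
  qed
  \<comment> \<open>Under the heading equation the denominators become
    \<open>\<alpha> + 2 * pi\<close> and the angles reduce to \<alpha>; without it both sides are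
    false.\<close>
  have EqR_iff: "EqR \<longleftrightarrow> \<theta>f = pi / 2 - \<alpha> + 2 * nR * pi \<and>
      XT0 - \<rho> * (\<alpha> + 2 * pi) * wx = \<rho> * (1 - cos \<alpha>) \<and> YT0 - \<rho> * (\<alpha> + 2 * pi) * wy = \<rho> * sin \<alpha>"
  proof (cases "\<theta>f = pi / 2 - \<alpha> + 2 * nR * pi")
    case True
    have d: "pi / 2 - \<theta>f + 2 * (nR + 1) * pi = \<alpha> + 2 * pi"
      using True by (simp add: algebra_simps)
    have e: "cos (pi / 2 + \<theta>f) = - cos \<alpha>" "sin (pi / 2 + \<theta>f) = sin \<alpha>"
      using nR01 by (auto simp: True sin_add cos_add sin_diff cos_diff)
    have f: "XT0 / \<rho> - - cos \<alpha> - 1 = XT0 / \<rho> - (1 - cos \<alpha>)"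
      by simp
    show ?thesis
      unfolding EqR_def d e f scaled ..
  qed (simp add: EqR_def)
  have EqL_iff: "EqL \<longleftrightarrow> \<theta>f = \<alpha> + pi / 2 - 2 * nL * pi \<and>
      XT0 - \<rho> * (\<alpha> + 2 * pi) * wx = \<rho> * (cos \<alpha> - 1) \<and> YT0 - \<rho> * (\<alpha> + 2 * pi) * wy = \<rho> * sin \<alpha>"
  proof (cases "\<theta>f = \<alpha> + pi / 2 - 2 * nL * pi")
    case True
    have d: "\<theta>f - pi / 2 + 2 * (nL + 1) * pi = \<alpha> + 2 * pi"
      using True by (simp add: algebra_simps)
    have e: "cos (\<theta>f - pi / 2) = cos \<alpha>" "sin (\<theta>f - pi / 2) = sin \<alpha>"
      using nL01 by (auto simp: True sin_add cos_add sin_diff cos_diff)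
    have f: "XT0 / \<rho> - cos \<alpha> + 1 = XT0 / \<rho> - (cos \<alpha> - 1)"
      by simp
    show ?thesis
      unfolding EqL_def d e f scaled ..
  qed (simp add: EqL_def)
  have RL_imp: EqR if RL: "RL_path \<rho> \<alpha> tf x y \<theta>"
  proof -
    have tf: "tf = \<rho> * (\<alpha> + 2 * pi)"
      \<comment> \<open>Writing \<open>1\<close> as \<open>- (-1)\<close> matches
        \<open>CC_path_end\<close> with \<open>s = -1\<close>.\<close>
      and path: "dubins_trajectory \<rho> tf (\<lambda>t. if t < \<rho> * \<alpha> then -1 else - (-1)) x y \<theta>"
      using RL unfolding RL_path_def minus_minus by blast+
    have e: "x tf = \<rho> * (1 - cos \<alpha>)" "y tf = \<rho> * sin \<alpha>" "\<theta> tf = pi / 2 - \<alpha> + 2 * pi"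
      using CC_path_end[OF assms(1) _ _ path tf] assms(4) by (simp_all add: algebra_simps)
    \<comment> \<open>For \<open>\<theta>f \<ge> pi / 2\<close> the difference bounded below is
      \<open>\<theta>f - pi / 2 + \<alpha> - 2 * pi\<close>, which exceeds \<open>- 2 * pi\<close>
      because \<alpha> is positive. At \<open>\<alpha> = 0\<close> and
      \<open>\<theta>f = pi / 2\<close> it would equal \<open>- 2 * pi\<close>.\<close>
    have "\<alpha> > 0"
      using nondegenerate RL assms(4) by auto
    have "\<theta>f = pi / 2 - \<alpha> + 2 * nR * pi"
    proof (rule representative_unique)
      \<comment> \<open>The conditional is \<open>1 - nR\<close> as an integer, the \<open>1\<close>
        being the full turn of the second arc.\<close>
      show "\<theta>f = pi / 2 - \<alpha> + 2 * nR * pi + 2 * pi * of_int ((if \<theta>f < pi / 2 then 1 else 0) - k)"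
        using e(3) target(3) by (simp add: nR_def algebra_simps)
      show "\<bar>\<theta>f - (pi / 2 - \<alpha> + 2 * nR * pi)\<bar> < 2 * pi"
        unfolding nR_def using assms(3,4) \<open>\<alpha> > 0\<close> by auto
    qed
    then show ?thesis
      unfolding EqR_iff using e target tf by simp
  qed
  have LR_imp: EqL if LR: "LR_path \<rho> \<alpha> tf x y \<theta>"
  proof -
    have tf: "tf = \<rho> * (\<alpha> + 2 * pi)"
      and path: "dubins_trajectory \<rho> tf (\<lambda>t. if t < \<rho> * \<alpha> then 1 else - 1) x y \<theta>"
      using LR unfolding LR_path_def by blast+
    have e: "x tf = \<rho> * (cos \<alpha> - 1)" "y tf = \<rho> * sin \<alpha>" "\<theta> tf = pi / 2 + \<alpha> - 2 * pi"
      using CC_path_end[OF assms(1) _ _ path tf] assms(4) by (simp_all add: algebra_simps)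
    have "\<theta>f = \<alpha> + pi / 2 - 2 * nL * pi"
    proof (rule representative_unique)
      \<comment> \<open>Here the conditional is \<open>nL - 1\<close>. The bound below is strict
        even at \<open>\<alpha> = 0\<close>, since \<open>nL = 1\<close> only for
        \<open>\<theta>f < pi / 2\<close>.\<close>
      show "\<theta>f = \<alpha> + pi / 2 - 2 * nL * pi + 2 * pi * of_int ((if \<theta>f \<ge> pi / 2 then -1 else 0) - k)"
        using e(3) target(3) by (simp add: nL_def algebra_simps)
      show "\<bar>\<theta>f - (\<alpha> + pi / 2 - 2 * nL * pi)\<bar> < 2 * pi"
        unfolding nL_def using assms(3,4) by auto
    qed
    then show ?thesis
      unfolding EqL_iff using e target tf by simp
  qed
  have "\<not> (EqR \<and> EqL)"
  proof
    assume both: "EqR \<and> EqL"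
    then have "\<rho> * (1 - cos \<alpha>) = \<rho> * (cos \<alpha> - 1)"
      unfolding EqR_iff EqL_iff by metis
    then have "\<alpha> = 0"
      using assms(1,4) cos_eq_1_in_period[of \<alpha>] by simp
    \<comment> \<open>The selection of \<open>nR\<close> refutes this: \<open>nR = 0\<close> would
      give \<open>\<theta>f = pi / 2\<close>, contrary to \<open>\<theta>f < pi / 2\<close>, and
      \<open>nR = 1\<close> would give \<open>5 * pi / 2\<close>, outside the range of
      \<open>\<theta>f\<close>.\<close>
    then have "\<theta>f = pi / 2 + 2 * nR * pi"
      using both unfolding EqR_def by simp
    then show False
      using assms(3) pi_gt_zero by (cases "\<theta>f < pi / 2") (auto simp: nR_def)
  qed
  \<comment> \<open>If \<open>EqR\<close> holds, an LR path would give \<open>EqL\<close> as well,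
    so \<open>CC_type\<close> leaves only RL; the other converse is symmetric.\<close>
  with CC_type RL_imp LR_imp
  have RL_iff: "RL_path \<rho> \<alpha> tf x y \<theta> \<longleftrightarrow> EqR" and LR_iff: "LR_path \<rho> \<alpha> tf x y \<theta> \<longleftrightarrow> EqL"
    by blast+
  \<comment> \<open>With \<open>T = \<rho> * (\<alpha> + 2 * pi)\<close>, the polynomial is the
    expansion of \<open>(XT0 - T * wx - \<rho>)^2 + (YT0 - T * wy)^2 - \<rho>^2\<close>; for
    \<open>quadL\<close> the center changes from \<open>\<rho>\<close> to
    \<open>- \<rho>\<close>.\<close>
  have quadR: "(\<rho>^2 * wy^2 + \<rho>^2 * wx^2) * \<alpha>^2
      + (4 * pi * \<rho>^2 * (wy^2 + wx^2) - 2 * \<rho> * (wy * YT0 + wx * XT0 - \<rho> * wx)) * \<alpha>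
      + (4 * pi^2 * \<rho>^2 * (wy^2 + wx^2) - 4 * pi * \<rho> * (wy * YT0 + wx * XT0 - \<rho> * wx)
               + YT0^2 + XT0^2 - 2 * \<rho> * XT0) = 0" if EqR
  proof -
    have X: "XT0 = \<rho> * (\<alpha> + 2 * pi) * wx + \<rho> * (1 - cos \<alpha>)"
      and Y: "YT0 = \<rho> * (\<alpha> + 2 * pi) * wy + \<rho> * sin \<alpha>"
      using that unfolding EqR_iff by auto
    show ?thesis using X Y circle by algebra
  qed
  have quadL: "(\<rho>^2 * wy^2 + \<rho>^2 * wx^2) * \<alpha>^2
      + (4 * pi * \<rho>^2 * (wy^2 + wx^2) - 2 * \<rho> * (wy * YT0 + wx * XT0 + \<rho> * wx)) * \<alpha>
      + (4 * pi^2 * \<rho>^2 * (wy^2 + wx^2) - 4 * pi * \<rho> * (wy * YT0 + wx * XT0 + \<rho> * wx)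
               + YT0^2 + XT0^2 + 2 * \<rho> * XT0) = 0" if EqL
  proof -
    have X: "XT0 = \<rho> * (\<alpha> + 2 * pi) * wx + \<rho> * (cos \<alpha> - 1)"
      and Y: "YT0 = \<rho> * (\<alpha> + 2 * pi) * wy + \<rho> * sin \<alpha>"
      using that unfolding EqL_iff by auto
    show ?thesis using X Y circle by algebra
  qed
  show ?thesis
    unfolding Let_def nR_def[symmetric] nL_def[symmetric] EqR_def[symmetric] EqL_def[symmetric]
    using RL_iff LR_iff quadR quadL by blast
qed

end
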